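(* Let $k\ge0$ be an integer, $n=2^k$, $\kappa_0\le\dots\le\kappa_{n-1}$ real numbers, $\kappa_{-1}=-\infty$, $\kappa_n=+\infty$, $\kappa'\le\kappa''$ real numbers, $r'=\min\{r\in[[-1,n]] : \kappa'\le\kappa_r\}$, $r''=\max\{r\in[[-1,n]] : \kappa_r\le\kappa''\}$, $s\in[[0,n-1]]$, and $0<p\le1$. Let $(\mathrm{success}(t))_{t\ge0}$ be independent events each of probability $p$. For $t\ge0$ let $x_t=\mathrm{rev}_k((s+t)\bmod n)$; $\mathrm{lb}_0=0$, $\mathrm{ub}_0=n-1$; $\mathrm{used}_t=1$ if $\mathrm{lb}_t\le x_t\le\mathrm{ub}_t$ and $0$ otherwise; if $\mathrm{used}_t=1$, $\mathrm{success}(t)$ holds and $\kappa_{x_t}<\kappa'$, then $(\mathrm{lb}_{t+1},\mathrm{ub}_{t+1})=(x_t+1,\mathrm{ub}_t)$; if $\mathrm{used}_t=1$, $\mathrm{success}(t)$ holds and $\kappa''<\kappa_{x_t}$, then $(\mathrm{lb}_{t+1},\mathrm{ub}_{t+1})=(\mathrm{lb}_t,x_t-1)$; otherwise $(\mathrm{lb}_{t+1},\mathrm{ub}_{t+1})=(\mathrm{lb}_t,\mathrm{ub}_t)$. Call receiver time $t\ge0$ a miss if $\mathrm{used}_t=1$ and $x_t\notin[[r',r'']]$. Then the expected total number of misses over all $t\ge0$ is at most $(8k+4)/p+2(1-p)/p^2$.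
   Context: $[[a,b]]=\{x\in\mathbb{Z}: a\le x\le b\}$; for $x=\sum_{i=0}^{k-1}x_i2^i\in[[0,2^k-1]]$, $\mathrm{rev}_k(x)=\sum_{i=0}^{k-1}x_i2^{k-1-i}$. Model: each reception attempt succeeds with probability $p$; on failure the receiver keeps its interval $[\mathrm{lb},\mathrm{ub}]$ unchanged. *)

theory Defs
  imports "HOL-Probability.Probability"
begin

definition rev_bits :: "nat \<Rightarrow> nat \<Rightarrow> nat" where
  "rev_bits k x = (\<Sum>i<k. (x div 2 ^ i mod 2) * 2 ^ (k - 1 - i))"

text \<open>The keys \<open>\<kappa> 0, \<dots>, \<kappa> (n - 1)\<close>, extended by \<open>- \<infinity>\<close> at index \<open>-1\<close> and by
  \<open>\<infinity>\<close> at index \<open>n\<close>.\<close>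

definition ext_key :: "nat \<Rightarrow> (nat \<Rightarrow> real) \<Rightarrow> int \<Rightarrow> ereal" where
  "ext_key n \<kappa> r = (if r < 0 then - \<infinity> else if int n \<le> r then \<infinity> else ereal (\<kappa> (nat r)))"

text \<open>The two sets below are finite and nonempty: they contain \<open>n\<close> and \<open>-1\<close>, respectively.\<close>

definition r_min :: "nat \<Rightarrow> (nat \<Rightarrow> real) \<Rightarrow> real \<Rightarrow> int" where
  "r_min n \<kappa> \<kappa>' = Min {r \<in> {- 1..int n}. ereal \<kappa>' \<le> ext_key n \<kappa> r}"

definition r_max :: "nat \<Rightarrow> (nat \<Rightarrow> real) \<Rightarrow> real \<Rightarrow> int" where
  "r_max n \<kappa> \<kappa>'' = Max {r \<in> {- 1..int n}. ext_key n \<kappa> r \<le> ereal \<kappa>''}"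

definition slot :: "nat \<Rightarrow> nat \<Rightarrow> nat \<Rightarrow> nat" where
  "slot k s t = rev_bits k ((s + t) mod 2 ^ k)"

text \<open>The receiver's interval \<open>(lb, ub)\<close> before time \<open>t\<close>, as a function of the sequence
  \<open>succ\<close> of reception outcomes. The bounds are integers, since \<open>ub\<close> may become \<open>-1\<close>.\<close>

primrec bounds ::
  "nat \<Rightarrow> (nat \<Rightarrow> real) \<Rightarrow> real \<Rightarrow> real \<Rightarrow> nat \<Rightarrow> (nat \<Rightarrow> bool) \<Rightarrow> nat \<Rightarrow> int \<times> int" where
  "bounds k \<kappa> \<kappa>' \<kappa>'' s succ 0 = (0, 2 ^ k - 1)"
| "bounds k \<kappa> \<kappa>' \<kappa>'' s succ (Suc t) =
    (let (lb, ub) = bounds k \<kappa> \<kappa>' \<kappa>'' s succ t; x = slot k s t;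
         used = (lb \<le> int x \<and> int x \<le> ub)
     in if used \<and> succ t \<and> \<kappa> x < \<kappa>' then (int x + 1, ub)
        else if used \<and> succ t \<and> \<kappa>'' < \<kappa> x then (lb, int x - 1)
        else (lb, ub))"

definition used ::
  "nat \<Rightarrow> (nat \<Rightarrow> real) \<Rightarrow> real \<Rightarrow> real \<Rightarrow> nat \<Rightarrow> (nat \<Rightarrow> bool) \<Rightarrow> nat \<Rightarrow> bool" where
  "used k \<kappa> \<kappa>' \<kappa>'' s succ t \<longleftrightarrow>
    (let (lb, ub) = bounds k \<kappa> \<kappa>' \<kappa>'' s succ t in lb \<le> int (slot k s t) \<and> int (slot k s t) \<le> ub)"

definition miss ::
  "nat \<Rightarrow> (nat \<Rightarrow> real) \<Rightarrow> real \<Rightarrow> real \<Rightarrow> nat \<Rightarrow> (nat \<Rightarrow> bool) \<Rightarrow> nat \<Rightarrow> bool" where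
  "miss k \<kappa> \<kappa>' \<kappa>'' s succ t \<longleftrightarrow>
    used k \<kappa> \<kappa>' \<kappa>'' s succ t \<and>
    int (slot k s t) \<notin> {r_min (2 ^ k) \<kappa> \<kappa>'..r_max (2 ^ k) \<kappa> \<kappa>''}"

end

theory Submission
  imports Defs
begin

text \<open>The lower and the upper end of the receiver's interval evolve independently of each other.
  On either side let \<open>d\<close> be the number of remaining slots on the wrong side of the key range, and
  let \<open>y\<close> be the distance of the current slot to that range. A miss means \<open>0 \<le> y < d\<close>, and a
  successful miss replaces \<open>d\<close> by \<open>y\<close>. Fix \<open>m \<le> k\<close> and call a miss good if \<open>y < 2 ^ m \<le> d\<close> and
  bad if \<open>2 ^ m \<le> y < d < 2 ^ (m + 1)\<close>; every miss is good or bad for some \<open>m\<close>. A successful good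
  miss brings \<open>d\<close> below \<open>2 ^ m\<close> for ever, so the expected number of good misses is at most
  \<open>1 / p\<close>. In an aligned block of \<open>2 ^ (k - m)\<close> time steps, the bit-reversed slots run through one
  residue class modulo \<open>2 ^ m\<close>. Hence a block contains at most one bad miss, and, unless it is
  the possibly incomplete initial block, a block with a bad miss also contains a good one. So bad misses exceed
  good ones by at most one, and there are none for \<open>m = k\<close>. This bounds the expected number of misses on
  one side by \<open>2 (k + 1) / p + k \<le> (4 k + 2) / p\<close>.\<close>

section \<open>Bit reversal\<close>

text \<open>Reversal moves the \<open>i\<close> low digits of \<open>x\<close> to the leading places
  and the next \<open>m\<close> digits to the \<open>m\<close> lowest places, so the digit sum is
  cut at position \<open>i\<close>.\<close>

lemma rev_bits_add:
  "rev_bits (i + m) x = 2 ^ m * rev_bits i x + rev_bits m (x div 2 ^ i)"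
proof -
  have "rev_bits (i + m) x =
      (\<Sum>l<i. x div 2 ^ l mod 2 * 2 ^ (i + m - 1 - l))
      + (\<Sum>l<m. x div 2 ^ (i + l) mod 2 * 2 ^ (i + m - 1 - (i + l)))"
    unfolding rev_bits_def lessThan_atLeast0
    by (subst sum.atLeastLessThan_concat[of 0 i "i + m", symmetric])
      (simp_all add: sum.shift_bounds_nat_ivl[of _ 0 i m, simplified add.commute, simplified]
        add.commute)
  also have "(\<Sum>l<i. x div 2 ^ l mod 2 * 2 ^ (i + m - 1 - l)) = 2 ^ m * rev_bits i x"
    unfolding rev_bits_def sum_distrib_left
  proof (rule sum.cong[OF refl])
    fix l assume "l \<in> {..<i}"
    then have "i + m - 1 - l = m + (i - 1 - l)"
      by auto
    then show "x div 2 ^ l mod 2 * 2 ^ (i + m - 1 - l) = 2 ^ m * (x div 2 ^ l mod 2 * 2 ^ (i - 1 - l))"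
      by (simp add: power_add)
  qed
  also have "(\<Sum>l<m. x div 2 ^ (i + l) mod 2 * 2 ^ (i + m - 1 - (i + l))) = rev_bits m (x div 2 ^ i)"
    unfolding rev_bits_def by (simp add: power_add div_mult2_eq)
  finally show ?thesis .
qed

lemma rev_bits_Suc: "rev_bits (Suc i) x = 2 ^ i * (x mod 2) + rev_bits i (x div 2)"
  using rev_bits_add[of 1 i x] by (simp add: rev_bits_def)

lemma rev_bits_less: "rev_bits i x < 2 ^ i"
proof (induction i arbitrary: x)
  case 0
  show ?case by (simp add: rev_bits_def)
next
  case (Suc i)
  have "2 ^ i * (x mod 2) \<le> 2 ^ i * (1::nat)"
    by (intro mult_le_mono2) (simp add: less_Suc_eq_le[symmetric])
  then have "rev_bits (Suc i) x \<le> 2 ^ i + rev_bits i (x div 2)"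
    unfolding rev_bits_Suc by linarith
  with Suc[of "x div 2"] show ?case
    by simp
qed

lemma rev_bits_eq_iff: "rev_bits i x = rev_bits i y \<longleftrightarrow> x mod 2 ^ i = y mod 2 ^ i"
proof (induction i arbitrary: x y)
  case 0
  show ?case by (simp add: rev_bits_def)
next
  case (Suc i)
  have split: "z mod 2 ^ Suc i = 2 * (z div 2 mod 2 ^ i) + z mod 2" for z :: nat
    by (simp add: mod_mult2_eq)
  have "rev_bits (Suc i) x = rev_bits (Suc i) y \<longleftrightarrow>
      x mod 2 = y mod 2 \<and> rev_bits i (x div 2) = rev_bits i (y div 2)" (is "?l = ?r")
  proof
    assume ?l
    then have eq: "2 ^ i * (x mod 2) + rev_bits i (x div 2) = 2 ^ i * (y mod 2) + rev_bits i (y div 2)"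
      by (simp add: rev_bits_Suc)
    have "x mod 2 = y mod 2"
      using arg_cong[OF eq, of "\<lambda>z. z div 2 ^ i"] by (simp add: rev_bits_less)
    with eq show ?r by simp
  qed (simp add: rev_bits_Suc)
  also have "\<dots> \<longleftrightarrow> x mod 2 = y mod 2 \<and> x div 2 mod 2 ^ i = y div 2 mod 2 ^ i"
    by (simp add: Suc)
  also have "\<dots> \<longleftrightarrow> x mod 2 ^ Suc i = y mod 2 ^ Suc i"
    unfolding split by (auto dest: arg_cong[of _ _ "\<lambda>z. z mod 2"])
  finally show ?case .
qed

lemma rev_bits_surj:
  assumes "q < 2 ^ i"
  obtains j where "j < 2 ^ i" "rev_bits i j = q"
proof -
  have "inj_on (rev_bits i) {..<2 ^ i}"
    by (auto intro!: inj_onI simp: rev_bits_eq_iff)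
  then have "rev_bits i ` {..<2 ^ i} = {..<2 ^ i}"
    by (intro card_subset_eq) (auto simp: card_image rev_bits_less)
  with assms that show thesis
    by (metis imageE lessThan_iff)
qed

text \<open>Equal quotients mean equal high digits, hence equal last \<open>m\<close> digits after
  reversal. So the two reversals differ by a nonzero multiple of \<open>2 ^ m\<close>.\<close>

lemma rev_bits_separated:
  assumes "m \<le> k" "u div 2 ^ (k - m) = v div 2 ^ (k - m)" "u \<noteq> v"
  shows "2 ^ m \<le> \<bar>int (rev_bits k u) - int (rev_bits k v)\<bar>"
proof -
  let ?i = "k - m"
  have rev: "rev_bits k w = 2 ^ m * rev_bits ?i w + rev_bits m (w div 2 ^ ?i)" for w
    using rev_bits_add[of ?i m w] assms(1) by simp
  have "u mod 2 ^ ?i \<noteq> v mod 2 ^ ?i"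
    using assms(2,3) by (metis div_mult_mod_eq)
  then have "int (rev_bits ?i u) - int (rev_bits ?i v) \<noteq> 0"
    by (simp add: rev_bits_eq_iff)
  then have "1 \<le> \<bar>int (rev_bits ?i u) - int (rev_bits ?i v)\<bar>"
    by linarith
  then have "2 ^ m * 1 \<le> 2 ^ m * \<bar>int (rev_bits ?i u) - int (rev_bits ?i v)\<bar>"
    by (intro mult_left_mono) auto
  also have "\<dots> = \<bar>2 ^ m * (int (rev_bits ?i u) - int (rev_bits ?i v))\<bar>"
    by (simp add: abs_mult)
  also have "2 ^ m * (int (rev_bits ?i u) - int (rev_bits ?i v)) = int (rev_bits k u) - int (rev_bits k v)"
    using assms(2) by (simp add: rev algebra_simps)
  finally show ?thesis by simp
qed

text \<open>Over block \<open>b\<close> the reversal takes every value below \<open>2 ^ k\<close>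
  that is congruent to \<open>rev_bits m b\<close> modulo \<open>2 ^ m\<close>, and a window of
  \<open>2 ^ m\<close> consecutive integers meets every residue class.\<close>

lemma rev_bits_dense:
  fixes w :: int
  assumes "m \<le> k" "0 \<le> w" "w + 2 ^ m \<le> 2 ^ k"
  obtains u where "u div 2 ^ (k - m) = b" "w \<le> int (rev_bits k u)" "int (rev_bits k u) < w + 2 ^ m"
proof -
  let ?i = "k - m"
  define c where "c = rev_bits m b"
  define x where "x = w + (int c - w) mod 2 ^ m"
  have bounds: "w \<le> x" "x < w + 2 ^ m"
    by (simp_all add: x_def)
  have c: "c < 2 ^ m"
    by (simp add: c_def rev_bits_less)
  have "x mod 2 ^ m = int c"
    using c by (simp add: x_def mod_add_right_eq)
  then have x: "x = 2 ^ m * (x div 2 ^ m) + int c"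
    using mult_div_mod_eq[of "2 ^ m" x] by simp
  have "0 \<le> x" "x < 2 ^ k"
    using bounds assms by auto
  have pow: "(2::int) ^ k = 2 ^ m * 2 ^ ?i"
    using assms(1) by (simp add: power_add[symmetric])
  have "2 ^ m * (x div 2 ^ m) < 2 ^ m * (2::int) ^ ?i"
    using x \<open>x < 2 ^ k\<close> pow by linarith
  then have "x div 2 ^ m < 2 ^ ?i"
    by simp
  moreover have "0 \<le> x div 2 ^ m"
    using \<open>0 \<le> x\<close> by (simp add: pos_imp_zdiv_nonneg_iff)
  ultimately have "nat (x div 2 ^ m) < 2 ^ ?i"
    by (simp add: nat_less_iff)
  then obtain j where j: "j < 2 ^ ?i" "rev_bits ?i j = nat (x div 2 ^ m)"
    by (rule rev_bits_surj)
  \<comment> \<open>The high digits \<open>b\<close> select the block; the low digits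
    \<open>j\<close> make the reversal start with the quotient of \<open>x\<close>.\<close>
  define u where "u = b * 2 ^ ?i + j"
  have u: "u div 2 ^ ?i = b" "rev_bits ?i u = rev_bits ?i j"
    using j(1) by (simp_all add: u_def rev_bits_eq_iff)
  have "rev_bits k u = 2 ^ m * nat (x div 2 ^ m) + c"
    using rev_bits_add[of ?i m u] assms(1) by (simp add: u j(2) c_def)
  then have "int (rev_bits k u) = x"
    using x \<open>0 \<le> x div 2 ^ m\<close> by simp
  with u(1) bounds that show thesis by simp
qed

text \<open>\<open>rev_bits k\<close> reads only the \<open>k\<close> low digits. Dropping the
  reduction lets blocks be indexed by quotients of the unreduced time \<open>s + t\<close>.\<close>

lemma slot_eq_rev_bits: "slot k s t = rev_bits k (s + t)"
  by (simp add: slot_def rev_bits_eq_iff)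

section \<open>Misses on one side\<close>

text \<open>The receiver seen from one side, starting with \<open>d\<close> wrong slots. A negative
  \<open>y t\<close> stands for a slot that is not on this side.\<close>

primrec gap :: "int \<Rightarrow> (nat \<Rightarrow> int) \<Rightarrow> (nat \<Rightarrow> bool) \<Rightarrow> nat \<Rightarrow> int" where
  "gap d y succ 0 = d"
| "gap d y succ (Suc t) =
    (if 0 \<le> y t \<and> y t < gap d y succ t \<and> succ t then y t else gap d y succ t)"

definition side_miss :: "int \<Rightarrow> (nat \<Rightarrow> int) \<Rightarrow> (nat \<Rightarrow> bool) \<Rightarrow> nat \<Rightarrow> bool" where
  "side_miss d y succ t \<longleftrightarrow> 0 \<le> y t \<and> y t < gap d y succ t"

text \<open>The inequalities around \<open>2 ^ m\<close> force \<open>y t\<close> below the gap, so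
  this is indeed a miss. One miss may be good for several \<open>m\<close>, which is harmless in a
  union bound.\<close>

definition good_miss :: "nat \<Rightarrow> int \<Rightarrow> (nat \<Rightarrow> int) \<Rightarrow> (nat \<Rightarrow> bool) \<Rightarrow> nat \<Rightarrow> bool" where
  "good_miss m d y succ t \<longleftrightarrow> 0 \<le> y t \<and> y t < 2 ^ m \<and> 2 ^ m \<le> gap d y succ t"

definition bad_miss :: "nat \<Rightarrow> int \<Rightarrow> (nat \<Rightarrow> int) \<Rightarrow> (nat \<Rightarrow> bool) \<Rightarrow> nat \<Rightarrow> bool" where
  "bad_miss m d y succ t \<longleftrightarrow>
    2 ^ m \<le> y t \<and> y t < gap d y succ t \<and> gap d y succ t < 2 ^ Suc m"

lemma gap_antimono: "t \<le> u \<Longrightarrow> gap d y succ u \<le> gap d y succ t"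
  by (induction u rule: dec_induct) auto

lemma gap_drop:
  assumes "t \<le> u" "c \<le> gap d y succ t" "gap d y succ u < c"
  obtains v where "t \<le> v" "v < u" "c \<le> gap d y succ v" "gap d y succ (Suc v) < c"
  using assms
proof (induction u arbitrary: thesis rule: dec_induct)
  case base
  then show ?case by simp
next
  case (step u)
  show ?case
  proof (cases "gap d y succ u < c")
    case True
    with step show ?thesis by (metis less_SucI)
  next
    case False
    with step show ?thesis by (metis lessI linorder_not_less)
  qed
qed

text \<open>Isolates what the counting uses of the slot sequence, so that both sides of the range
  become instances. \<open>Y\<close> is indexed by unreduced time. In the instances,
  \<open>2 ^ m \<le> d\<close> keeps the window of \<open>2 ^ m\<close> slots next to the range
  among the \<open>2 ^ k\<close> slots.\<close>

locale target_scan =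
  fixes k s :: nat and Y :: "nat \<Rightarrow> int" and d :: int
  assumes d_le: "d \<le> 2 ^ k"
    and separated: "\<And>m u v. m \<le> k \<Longrightarrow> u div 2 ^ (k - m) = v div 2 ^ (k - m) \<Longrightarrow> u \<noteq> v
      \<Longrightarrow> 2 ^ m \<le> \<bar>Y u - Y v\<bar>"
    and dense: "\<And>m b. m \<le> k \<Longrightarrow> 2 ^ m \<le> d
      \<Longrightarrow> \<exists>u. u div 2 ^ (k - m) = b \<and> 0 \<le> Y u \<and> Y u < 2 ^ m"
begin

abbreviation y :: "nat \<Rightarrow> int" where
  "y \<equiv> \<lambda>t. Y (s + t)"

text \<open>Density puts a time \<open>w\<close> with \<open>0 \<le> Y w < 2 ^ m\<close> into the
  block of the bad miss. Either the gap is still at least \<open>2 ^ m\<close> then, which makes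
  that time a good miss, or the gap has crossed \<open>2 ^ m\<close> between the two times, which
  only a good miss can cause.\<close>

lemma bad_miss_imp_good_miss:
  assumes "m \<le> k" "bad_miss m d y succ t" "(s + t) div 2 ^ (k - m) \<noteq> s div 2 ^ (k - m)"
  obtains v where "good_miss m d y succ v" "(s + v) div 2 ^ (k - m) = (s + t) div 2 ^ (k - m)"
proof -
  let ?B = "2 ^ (k - m) :: nat"
  from assms(2) have t: "2 ^ m \<le> y t" "y t < gap d y succ t"
    by (auto simp: bad_miss_def)
  have "gap d y succ t \<le> d"
    using gap_antimono[of 0 t d y succ] by simp
  with t have "2 ^ m \<le> d" by linarith
  then obtain w where w: "w div ?B = (s + t) div ?B" "0 \<le> Y w" "Y w < 2 ^ m"
    using dense[OF assms(1)] by blast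
  \<comment> \<open>The block is not the one containing \<open>s\<close>, so it lies wholly after
    \<open>s\<close>, and \<open>w\<close> is a genuine receiver time.\<close>
  have "s div ?B < w div ?B"
    using assms(3) div_le_mono[of s "s + t" ?B] w(1) by simp
  then have "s \<le> w"
    by (meson div_le_mono leD nat_le_linear)
  then obtain u where u: "w = s + u"
    by (metis le_add_diff_inverse)
  show thesis
  proof (cases "2 ^ m \<le> gap d y succ u")
    case True
    with w u that[of u] show ?thesis by (simp add: good_miss_def)
  next
    case False
    then have low: "gap d y succ u < 2 ^ m" by simp
    have "t \<le> u"
    proof (rule ccontr)
      assume "\<not> t \<le> u"
      then have "gap d y succ t \<le> gap d y succ u"
        by (intro gap_antimono) simp
      with low t show False by linarith
    qed
    moreover have "2 ^ m \<le> gap d y succ t"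
      using t by linarith
    ultimately obtain v where v: "t \<le> v" "v < u" "2 ^ m \<le> gap d y succ v" "gap d y succ (Suc v) < 2 ^ m"
      using low gap_drop by metis
    \<comment> \<open>The gap changes only by taking the value \<open>y v \<ge> 0\<close>, so its
      fall below \<open>2 ^ m\<close> forces \<open>y v < 2 ^ m\<close>.\<close>
    then have "good_miss m d y succ v"
      by (auto simp: good_miss_def split: if_splits)
    moreover have "(s + v) div ?B = (s + t) div ?B"
      using v(1,2) w(1) u div_le_mono[of "s + t" "s + v" ?B] div_le_mono[of "s + v" "s + u" ?B]
      by (intro antisym) simp_all
    ultimately show ?thesis by (rule that)
  qed
qed

text \<open>Bad misses have \<open>y\<close> between \<open>2 ^ m\<close> and
  \<open>2 ^ (m + 1)\<close>, the latter excluded, so two of them are closer than separation within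
  a block allows.\<close>

lemma inj_on_bad_miss:
  assumes "m \<le> k"
  shows "inj_on (\<lambda>t. (s + t) div 2 ^ (k - m)) {t. bad_miss m d y succ t}"
proof (rule inj_onI, rule ccontr)
  fix t u assume *: "t \<in> {t. bad_miss m d y succ t}" "u \<in> {t. bad_miss m d y succ t}"
    "(s + t) div 2 ^ (k - m) = (s + u) div 2 ^ (k - m)" "t \<noteq> u"
  then have "2 ^ m \<le> \<bar>y t - y u\<bar>"
    by (intro separated[OF assms]) auto
  moreover have "2 ^ m \<le> y t" "y t < 2 * 2 ^ m" "2 ^ m \<le> y u" "y u < 2 * 2 ^ m"
    using * by (auto simp: bad_miss_def)
  ultimately show False by linarith
qed

abbreviation count :: "nat set \<Rightarrow> ennreal" where
  "count A \<equiv> emeasure (count_space UNIV) A"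

text \<open>Sending a bad miss to its block is injective, and each such block other than the initial
  one, \<open>?f 0\<close>, also holds a good miss. For \<open>m = k\<close> a bad miss would need a
  gap above \<open>2 ^ k \<ge> d\<close>.\<close>

lemma count_bad_miss_le:
  assumes "m \<le> k"
  shows "count {t. bad_miss m d y succ t} \<le> count {t. good_miss m d y succ t} + of_bool (m < k)"
proof (cases "m < k")
  case False
  then have "\<not> bad_miss m d y succ t" for t
    using gap_antimono[of 0 t d y succ] d_le assms by (auto simp: bad_miss_def)
  then show ?thesis by simp
next
  case True
  let ?f = "\<lambda>t. (s + t) div 2 ^ (k - m)"
  let ?bad = "{t. bad_miss m d y succ t}" and ?good = "{t. good_miss m d y succ t}"
  show ?thesis
  proof (cases "finite ?good")
    case fin: True
    have sub: "?f ` ?bad \<subseteq> insert (?f 0) (?f ` ?good)"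
    proof (rule image_subsetI)
      fix t assume t: "t \<in> ?bad"
      show "?f t \<in> insert (?f 0) (?f ` ?good)"
      proof (cases "?f t = ?f 0")
        case False
        with t obtain v where "good_miss m d y succ v" "?f v = ?f t"
          using bad_miss_imp_good_miss[OF assms, of succ t] by auto
        then have "?f v \<in> ?f ` ?good"
          by (intro imageI) simp
        with \<open>?f v = ?f t\<close> show ?thesis by simp
      qed simp
    qed
    have "finite ?bad"
      using finite_subset[OF sub] fin finite_imageD[OF _ inj_on_bad_miss[OF assms]] by blast
    have "card ?bad = card (?f ` ?bad)"
      by (simp add: card_image[OF inj_on_bad_miss[OF assms]])
    also have "\<dots> \<le> card (insert (?f 0) (?f ` ?good))"
      using fin by (intro card_mono sub) simp
    also have "\<dots> \<le> Suc (card (?f ` ?good))"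
      using fin by (intro card_insert_le_m1) auto
    also have "\<dots> \<le> Suc (card ?good)"
      using card_image_le[OF fin] by simp
    finally have "of_nat (card ?bad) \<le> (of_nat (Suc (card ?good)) :: ennreal)"
      by (simp only: of_nat_le_iff)
    with True fin \<open>finite ?bad\<close> show ?thesis
      by (simp add: add.commute)
  next
    case False
    \<comment> \<open>Infinitely many good misses make the right-hand side infinite.\<close>
    then show ?thesis by simp
  qed
qed

text \<open>For the greatest \<open>m\<close> with \<open>2 ^ m\<close> at most the gap, the gap is
  below \<open>2 ^ (m + 1)\<close>, and comparing \<open>y t\<close> with \<open>2 ^ m\<close>
  decides the kind.\<close>

lemma side_miss_cases:
  assumes "side_miss d y succ t"
  obtains m where "m \<le> k" "good_miss m d y succ t \<or> bad_miss m d y succ t"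
proof -
  let ?g = "gap d y succ t"
  have g: "1 \<le> ?g" "?g \<le> 2 ^ k"
    using assms gap_antimono[of 0 t d y succ] d_le by (auto simp: side_miss_def)
  let ?P = "\<lambda>m. (2::int) ^ m \<le> ?g"
  have bound: "m \<le> k" if "?P m" for m
    using order_trans[OF that g(2)] by simp
  define m where "m = (GREATEST m. ?P m)"
  have "?P 0" using g by simp
  then have m: "?P m"
    unfolding m_def using bound by (rule GreatestI_nat)
  have "\<not> ?P (Suc m)"
    using Greatest_le_nat[of ?P "Suc m" k] bound unfolding m_def[symmetric] by auto
  with m assms have "good_miss m d y succ t \<or> bad_miss m d y succ t"
    by (auto simp: side_miss_def good_miss_def bad_miss_def)
  with bound[OF m] that show thesis by blast
qed

text \<open>A union bound over \<open>m \<le> k\<close> and both kinds: good misses are counted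
  twice, and the initial block is charged once for each \<open>m < k\<close>.\<close>

lemma count_side_miss_le:
  "count {t. side_miss d y succ t} \<le> (\<Sum>m\<le>k. 2 * count {t. good_miss m d y succ t}) + of_nat k"
proof -
  have "count {t. side_miss d y succ t}
      \<le> count (\<Union>m\<le>k. {t. good_miss m d y succ t} \<union> {t. bad_miss m d y succ t})"
    by (intro emeasure_mono) (auto elim!: side_miss_cases)
  also have "\<dots> \<le> (\<Sum>m\<le>k. count ({t. good_miss m d y succ t} \<union> {t. bad_miss m d y succ t}))"
    by (intro emeasure_subadditive_finite) auto
  also have "\<dots> \<le> (\<Sum>m\<le>k. count {t. good_miss m d y succ t} + count {t. bad_miss m d y succ t})"
    by (intro sum_mono emeasure_subadditive) auto
  also have "\<dots> \<le> (\<Sum>m\<le>k. count {t. good_miss m d y succ t}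
      + (count {t. good_miss m d y succ t} + of_bool (m < k)))"
    by (intro sum_mono add_left_mono count_bad_miss_le) simp
  also have "\<dots> = (\<Sum>m\<le>k. 2 * count {t. good_miss m d y succ t}) + (\<Sum>m\<le>k. of_bool (m < k))"
    unfolding sum.distrib[symmetric] by (simp only: mult_2 add.assoc)
  also have "(\<Sum>m\<le>k. of_bool (m < k)) = (of_nat k :: ennreal)"
  proof -
    have "{..k} \<inter> {m. m < k} = {..<k}" by auto
    then show ?thesis by simp
  qed
  finally show ?thesis .
qed

end

section \<open>Expected number of misses on one side\<close>

text \<open>\<open>N\<close> is arbitrary and only outcomes before \<open>t\<close> must belong to
  it, so the result applies to the sigma-algebra of the past as well as to \<open>M\<close>.\<close>

lemma measurable_gap:
  assumes "\<And>i. i < t \<Longrightarrow> S i \<in> sets N"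
  shows "(\<lambda>\<omega>. gap d y (\<lambda>i. \<omega> \<in> S i) t) \<in> measurable N (count_space UNIV)"
  using assms
proof (induction t)
  case 0
  show ?case by simp
next
  case (Suc t)
  have [measurable]: "(\<lambda>\<omega>. gap d y (\<lambda>i. \<omega> \<in> S i) t) \<in> measurable N (count_space UNIV)"
    using Suc by simp
  have [measurable]: "S t \<in> sets N"
    using Suc by simp
  show ?case
    unfolding gap.simps by measurable
qed

lemma suminf_of_bool_eq_count:
  "(\<Sum>t. of_bool (P t)) = emeasure (count_space UNIV) {t::nat. P t}"
proof -
  have "(\<Sum>t. of_bool (P t)) = (\<Sum>t. indicator {t. P t} t :: ennreal)"
    by (intro arg_cong[where f = suminf] ext) (simp add: indicator_def)
  also have "\<dots> = emeasure (count_space UNIV) {t. P t}"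
    by (simp add: nn_integral_count_space_nat[symmetric])
  finally show ?thesis .
qed

context prob_space
begin

lemma indep_events_past:
  fixes t :: nat
  assumes "indep_events S UNIV" "E \<in> sigma_sets (space M) (S ` {..<t})"
  shows "prob (E \<inter> S t) = prob E * prob (S t)"
proof -
  let ?I = "case_bool {..<t} {t}"
  have "indep_sets (\<lambda>i. {S i}) (\<Union>b\<in>UNIV. ?I b)"
    using assms(1) unfolding indep_events_def_alt by (rule indep_sets_mono_index[rotated]) simp
  then have "indep_sets (\<lambda>b. sigma_sets (space M) (\<Union>i\<in>?I b. {S i})) UNIV"
    by (rule indep_sets_collect_sigma)
      (auto simp: Int_stable_def disjoint_family_on_def split: bool.splits)
  also have "(\<lambda>b. sigma_sets (space M) (\<Union>i\<in>?I b. {S i})) =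
      case_bool (sigma_sets (space M) (S ` {..<t})) (sigma_sets (space M) {S t})"
    by (auto simp: fun_eq_iff UNION_singleton_eq_range split: bool.splits)
  finally have "indep_set (sigma_sets (space M) (S ` {..<t})) (sigma_sets (space M) {S t})"
    unfolding indep_set_def .
  then show ?thesis
    using assms(2) by (rule indep_setD) simp
qed

text \<open>Whether time \<open>t\<close> is a good miss depends on earlier outcomes only, hence is
  independent of \<open>S t\<close>. Successful good misses are disjoint events, so their
  probabilities \<open>p * prob (G t)\<close> sum to at most 1.\<close>

lemma expected_good_misses:
  assumes indep: "indep_events S UNIV" and p: "\<And>t. prob (S t) = p" "0 < p"
  shows "(\<integral>\<^sup>+\<omega>. emeasure (count_space UNIV) {t. good_miss m d y (\<lambda>i. \<omega> \<in> S i) t} \<partial>M)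
    \<le> ennreal (1 / p)"
proof -
  have S [measurable]: "S t \<in> events" for t
    using indep by (auto simp: indep_events_def)
  define G where "G t = {\<omega> \<in> space M. good_miss m d y (\<lambda>i. \<omega> \<in> S i) t}" for t
  have past: "G t \<in> sigma_sets (space M) (S ` {..<t})" for t
  proof -
    let ?N = "sigma (space M) (S ` {..<t})"
    have sub: "S ` {..<t} \<subseteq> Pow (space M)"
      using S sets.sets_into_space by blast
    have [measurable]: "(\<lambda>\<omega>. gap d y (\<lambda>i. \<omega> \<in> S i) t) \<in> measurable ?N (count_space UNIV)"
      using sub by (intro measurable_gap) (auto simp: sets_measure_of)
    have "{\<omega> \<in> space ?N. good_miss m d y (\<lambda>i. \<omega> \<in> S i) t} \<in> sets ?N"
      unfolding good_miss_def by measurable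
    then show ?thesis
      using sub by (simp add: G_def sets_measure_of space_measure_of)
  qed
  have "sigma_sets (space M) (S ` {..<t}) \<subseteq> events" for t
    using S by (intro sets.sigma_sets_subset) auto
  with past have G [measurable]: "G t \<in> events" for t by blast
  have disj: "disjoint_family (\<lambda>t. G t \<inter> S t)"
  proof -
    have "\<omega> \<notin> G u" if "\<omega> \<in> G t \<inter> S t" "t < u" for \<omega> t u
    proof -
      have "gap d y (\<lambda>i. \<omega> \<in> S i) u \<le> gap d y (\<lambda>i. \<omega> \<in> S i) (Suc t)"
        using that by (intro gap_antimono) simp
      also have "\<dots> < 2 ^ m"
        using that by (auto simp: G_def good_miss_def)
      finally show ?thesis by (simp add: G_def good_miss_def)
    qed
    then show ?thesis
      unfolding disjoint_family_on_def by (metis (no_types, lifting) IntD1 disjoint_iff nat_neq_iff)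
  qed
  have "(\<Sum>t. emeasure M (G t)) * ennreal p = (\<Sum>t. emeasure M (G t \<inter> S t))"
    unfolding ennreal_suminf_multc[symmetric]
    using indep_events_past[OF indep past] p
    by (simp add: emeasure_eq_measure ennreal_mult)
  also have "\<dots> = emeasure M (\<Union>t. G t \<inter> S t)"
    using disj by (intro suminf_emeasure) auto
  also have "\<dots> \<le> 1"
    by (rule emeasure_le_1)
  finally have *: "(\<Sum>t. emeasure M (G t)) * ennreal p \<le> 1" .
  have "(\<integral>\<^sup>+\<omega>. emeasure (count_space UNIV) {t. good_miss m d y (\<lambda>i. \<omega> \<in> S i) t} \<partial>M)
      = (\<integral>\<^sup>+\<omega>. (\<Sum>t. indicator (G t) \<omega>) \<partial>M)"
    unfolding suminf_of_bool_eq_count[symmetric]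
    by (intro nn_integral_cong arg_cong[where f = suminf] ext) (simp add: G_def indicator_def)
  also have "\<dots> = (\<Sum>t. emeasure M (G t))"
    by (simp add: nn_integral_suminf)
  \<comment> \<open>Inserting \<open>p\<close> and \<open>1 / p\<close> is valid even for an
    infinite sum, because \<open>p\<close> is positive and finite.\<close>
  also have "\<dots> = (\<Sum>t. emeasure M (G t)) * ennreal p * ennreal (1 / p)"
    using p by (simp add: mult.assoc ennreal_mult[symmetric])
  also have "\<dots> \<le> 1 * ennreal (1 / p)"
    by (intro mult_right_mono *) simp
  finally show ?thesis by simp
qed

lemma expected_side_misses:
  assumes scan: "target_scan k Y d"
    and indep: "indep_events S UNIV" and p: "\<And>t. prob (S t) = p" "0 < p" "p \<le> 1"
  shows "(\<integral>\<^sup>+\<omega>. emeasure (count_space UNIV) {t. side_miss d (\<lambda>t. Y (s + t)) (\<lambda>i. \<omega> \<in> S i) t} \<partial>M)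
    \<le> ennreal ((4 * real k + 2) / p)"
proof -
  let ?y = "\<lambda>t. Y (s + t)"
  have S [measurable]: "S t \<in> events" for t
    using indep by (auto simp: indep_events_def)
  have [measurable]: "(\<lambda>\<omega>. gap d ?y (\<lambda>i. \<omega> \<in> S i) t) \<in> measurable M (count_space UNIV)" for t
    by (intro measurable_gap S)
  have [measurable]: "(\<lambda>\<omega>. emeasure (count_space UNIV) {t. good_miss m d ?y (\<lambda>i. \<omega> \<in> S i) t})
      \<in> borel_measurable M" for m
    unfolding suminf_of_bool_eq_count[symmetric] good_miss_def by measurable
  have "(\<integral>\<^sup>+\<omega>. emeasure (count_space UNIV) {t. side_miss d ?y (\<lambda>i. \<omega> \<in> S i) t} \<partial>M)
      \<le> (\<integral>\<^sup>+\<omega>. (\<Sum>m\<le>k. 2 * emeasure (count_space UNIV) {t. good_miss m d ?y (\<lambda>i. \<omega> \<in> S i) t})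
          + of_nat k \<partial>M)"
    by (intro nn_integral_mono target_scan.count_side_miss_le[OF scan])
  also have "\<dots> = (\<Sum>m\<le>k. 2 * (\<integral>\<^sup>+\<omega>. emeasure (count_space UNIV)
      {t. good_miss m d ?y (\<lambda>i. \<omega> \<in> S i) t} \<partial>M)) + of_nat k"
    by (simp add: nn_integral_add nn_integral_sum nn_integral_cmult emeasure_space_1)
  also have "\<dots> \<le> (\<Sum>m\<le>k. 2 * ennreal (1 / p)) + of_nat k"
    by (intro add_right_mono sum_mono mult_left_mono expected_good_misses indep p) simp
  also have "\<dots> = ennreal (2 * (real k + 1) / p + real k)"
    using p by (simp add: ennreal_of_nat_eq_real_of_nat ennreal_mult[symmetric]
        ennreal_plus[symmetric] ennreal_numeral[symmetric] del: ennreal_plus ennreal_numeral)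
  also have "\<dots> \<le> ennreal ((4 * real k + 2) / p)"
  proof (rule ennreal_leI)
    \<comment> \<open>Multiplied by \<open>p\<close>, the claim reads
      \<open>2 * (k + 1) + p * k \<le> 4 * k + 2\<close>, which follows from
      \<open>p * k \<le> k\<close>.\<close>
    have "p * real k \<le> 1 * real k"
      using p by (intro mult_right_mono) auto
    then have "2 * (real k + 1) + p * real k \<le> 4 * real k + 2"
      by (simp add: algebra_simps)
    then show "2 * (real k + 1) / p + real k \<le> (4 * real k + 2) / p"
      using p by (simp add: field_simps)
  qed
  finally show ?thesis .
qed

end

section \<open>The receiver\<close>

lemma less_r_min_iff:
  assumes "mono_on {..<n} \<kappa>" "x < n"
  shows "int x < r_min n \<kappa> \<kappa>' \<longleftrightarrow> \<kappa> x < \<kappa>'"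
proof -
  let ?R = "{r \<in> {- 1..int n}. ereal \<kappa>' \<le> ext_key n \<kappa> r}"
  have fin: "finite ?R" "int n \<in> ?R"
    by (auto simp: ext_key_def intro: finite_subset[of _ "{- 1..int n}"])
  then have "int x < r_min n \<kappa> \<kappa>' \<longleftrightarrow> (\<forall>r\<in>?R. int x < r)"
    unfolding r_min_def by (subst Min_gr_iff) auto
  also have "\<dots> \<longleftrightarrow> \<kappa> x < \<kappa>'"
  proof
    assume "\<forall>r\<in>?R. int x < r"
    then have "int x \<notin> ?R" by (meson less_irrefl)
    then have "ext_key n \<kappa> (int x) < ereal \<kappa>'"
      using assms(2) by (auto simp: not_le)
    then show "\<kappa> x < \<kappa>'"
      using assms(2) by (simp add: ext_key_def)
  next
    assume less: "\<kappa> x < \<kappa>'"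
    show "\<forall>r\<in>?R. int x < r"
    proof (rule ballI, rule ccontr)
      fix r assume r: "r \<in> ?R" "\<not> int x < r"
      \<comment> \<open>The index \<open>-1\<close> is no candidate, since its key is
        \<open>- \<infinity>\<close>. So \<open>r\<close> is a true slot, and monotonicity
        contradicts \<open>\<kappa> x < \<kappa>'\<close>.\<close>
      then have "0 \<le> r" "nat r \<le> x" "\<kappa>' \<le> \<kappa> (nat r)"
        using assms(2) by (auto simp: ext_key_def split: if_splits)
      then show False
        using less mono_onD[OF assms(1), of "nat r" x] assms(2) by auto
    qed
  qed
  finally show ?thesis .
qed

lemma r_max_less_iff:
  assumes "mono_on {..<n} \<kappa>" "x < n"
  shows "r_max n \<kappa> \<kappa>'' < int x \<longleftrightarrow> \<kappa>'' < \<kappa> x"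
proof -
  let ?R = "{r \<in> {- 1..int n}. ext_key n \<kappa> r \<le> ereal \<kappa>''}"
  have fin: "finite ?R" "- 1 \<in> ?R"
    by (auto simp: ext_key_def intro: finite_subset[of _ "{- 1..int n}"])
  then have "r_max n \<kappa> \<kappa>'' < int x \<longleftrightarrow> (\<forall>r\<in>?R. r < int x)"
    unfolding r_max_def by (subst Max_less_iff) auto
  also have "\<dots> \<longleftrightarrow> \<kappa>'' < \<kappa> x"
  proof
    assume "\<forall>r\<in>?R. r < int x"
    then have "int x \<notin> ?R" by (meson less_irrefl)
    then have "ereal \<kappa>'' < ext_key n \<kappa> (int x)"
      using assms(2) by (auto simp: not_le)
    then show "\<kappa>'' < \<kappa> x"
      using assms(2) by (simp add: ext_key_def)
  next
    assume less: "\<kappa>'' < \<kappa> x"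
    show "\<forall>r\<in>?R. r < int x"
    proof (rule ballI, rule ccontr)
      fix r assume r: "r \<in> ?R" "\<not> r < int x"
      then have "x \<le> nat r" "nat r < n" "\<kappa> (nat r) \<le> \<kappa>''"
        by (auto simp: ext_key_def split: if_splits)
      then show False
        using less mono_onD[OF assms(1), of x "nat r"] assms(2) by auto
    qed
  qed
  finally show ?thesis .
qed

lemma r_min_bounds: "0 \<le> r_min n \<kappa> \<kappa>'" "r_min n \<kappa> \<kappa>' \<le> int n"
proof -
  let ?R = "{r \<in> {- 1..int n}. ereal \<kappa>' \<le> ext_key n \<kappa> r}"
  have fin: "finite ?R" "int n \<in> ?R"
    by (auto simp: ext_key_def intro: finite_subset[of _ "{- 1..int n}"])
  then show "r_min n \<kappa> \<kappa>' \<le> int n"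
    unfolding r_min_def by (rule Min_le)
  have "r_min n \<kappa> \<kappa>' \<in> ?R"
    unfolding r_min_def using fin by (intro Min_in) auto
  then show "0 \<le> r_min n \<kappa> \<kappa>'"
    by (auto simp: ext_key_def split: if_splits)
qed

lemma r_max_bounds: "- 1 \<le> r_max n \<kappa> \<kappa>''" "r_max n \<kappa> \<kappa>'' < int n"
proof -
  let ?R = "{r \<in> {- 1..int n}. ext_key n \<kappa> r \<le> ereal \<kappa>''}"
  have fin: "finite ?R" "- 1 \<in> ?R"
    by (auto simp: ext_key_def intro: finite_subset[of _ "{- 1..int n}"])
  then show "- 1 \<le> r_max n \<kappa> \<kappa>''"
    unfolding r_max_def by (rule Max_ge)
  have "r_max n \<kappa> \<kappa>'' \<in> ?R"
    unfolding r_max_def using fin by (intro Max_in) auto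
  then show "r_max n \<kappa> \<kappa>'' < int n"
    by (auto simp: ext_key_def split: if_splits)
qed

text \<open>Otherwise the slot just above \<open>r_max\<close> would have a key both below
  \<open>\<kappa>'\<close> and above \<open>\<kappa>''\<close>. Equality means that no slot lies in
  the range; in every case the two wrong sides are disjoint.\<close>

lemma r_min_le_Suc_r_max:
  assumes "mono_on {..<n} \<kappa>" "\<kappa>' \<le> \<kappa>''"
  shows "r_min n \<kappa> \<kappa>' \<le> r_max n \<kappa> \<kappa>'' + 1"
proof (rule ccontr)
  assume *: "\<not> ?thesis"
  define x where "x = nat (r_max n \<kappa> \<kappa>'' + 1)"
  have x: "int x = r_max n \<kappa> \<kappa>'' + 1"
    using r_max_bounds(1)[of n \<kappa> \<kappa>''] by (simp add: x_def)
  then have "x < n"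
    using * r_min_bounds(2)[of n \<kappa> \<kappa>'] by linarith
  with x * have "\<kappa> x < \<kappa>'" "\<kappa>'' < \<kappa> x"
    by (simp_all flip: less_r_min_iff[OF assms(1)] r_max_less_iff[OF assms(1)])
  with assms(2) show False by linarith
qed

text \<open>Success at \<open>x < L\<close> moves the lower end to
  \<open>x + 1 = L - (L - 1 - x)\<close>, so the gap becomes the distance \<open>y\<close>; the
  upper end is symmetric. With nonnegative gaps and \<open>L \<le> R + 1\<close>, a slot on one
  wrong side automatically passes the test at the other end.\<close>

lemma bounds_eq_gap:
  fixes \<kappa> :: "nat \<Rightarrow> real"
  assumes mono: "mono_on {..<2 ^ k} \<kappa>" and le: "\<kappa>' \<le> \<kappa>''"
  defines "L \<equiv> r_min (2 ^ k) \<kappa> \<kappa>'" and "R \<equiv> r_max (2 ^ k) \<kappa> \<kappa>''"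
  shows "bounds k \<kappa> \<kappa>' \<kappa>'' s succ t =
      (L - gap L (\<lambda>t. L - 1 - int (slot k s t)) succ t,
       R + gap (2 ^ k - 1 - R) (\<lambda>t. int (slot k s t) - R - 1) succ t)
    \<and> 0 \<le> gap L (\<lambda>t. L - 1 - int (slot k s t)) succ t
    \<and> 0 \<le> gap (2 ^ k - 1 - R) (\<lambda>t. int (slot k s t) - R - 1) succ t"
proof (induction t)
  case 0
  show ?case
    using r_min_bounds[of "2 ^ k" \<kappa> \<kappa>'] r_max_bounds[of "2 ^ k" \<kappa> \<kappa>''] by (simp add: L_def R_def)
next
  case (Suc t)
  define x where "x = slot k s t"
  have "x < 2 ^ k"
    by (simp add: x_def slot_eq_rev_bits rev_bits_less)
  then have iff: "\<kappa> x < \<kappa>' \<longleftrightarrow> int x < L" "\<kappa>'' < \<kappa> x \<longleftrightarrow> R < int x"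
    using less_r_min_iff[OF mono] r_max_less_iff[OF mono] by (auto simp: L_def R_def)
  have "L \<le> R + 1"
    unfolding L_def R_def by (rule r_min_le_Suc_r_max[OF mono le])
  with Suc iff show ?case
    by (auto simp: Let_def x_def)
qed

lemma miss_iff_side_miss:
  fixes \<kappa> :: "nat \<Rightarrow> real"
  assumes mono: "mono_on {..<2 ^ k} \<kappa>" and le: "\<kappa>' \<le> \<kappa>''"
  defines "L \<equiv> r_min (2 ^ k) \<kappa> \<kappa>'" and "R \<equiv> r_max (2 ^ k) \<kappa> \<kappa>''"
  shows "miss k \<kappa> \<kappa>' \<kappa>'' s succ t \<longleftrightarrow>
    side_miss L (\<lambda>t. L - 1 - int (slot k s t)) succ t \<or>
    side_miss (2 ^ k - 1 - R) (\<lambda>t. int (slot k s t) - R - 1) succ t"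
proof -
  define x where "x = int (slot k s t)"
  define a where "a = gap L (\<lambda>t. L - 1 - int (slot k s t)) succ t"
  define b where "b = gap (2 ^ k - 1 - R) (\<lambda>t. int (slot k s t) - R - 1) succ t"
  have bounds: "bounds k \<kappa> \<kappa>' \<kappa>'' s succ t = (L - a, R + b)" "0 \<le> a" "0 \<le> b"
    using bounds_eq_gap[OF mono le, of s succ t] by (simp_all add: L_def R_def a_def b_def)
  have "L \<le> R + 1"
    unfolding L_def R_def by (rule r_min_le_Suc_r_max[OF mono le])
  then have "L - a \<le> x \<and> x \<le> R + b \<and> \<not> (L \<le> x \<and> x \<le> R) \<longleftrightarrow>
      0 \<le> L - 1 - x \<and> L - 1 - x < a \<or> 0 \<le> x - R - 1 \<and> x - R - 1 < b"
    using bounds(2,3) by linarith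
  then show ?thesis
    unfolding miss_def used_def side_miss_def bounds(1) L_def[symmetric] R_def[symmetric]
      a_def[symmetric] b_def[symmetric] x_def[symmetric]
    by simp
qed

lemma target_scan_below:
  assumes "L \<le> 2 ^ k"
  shows "target_scan k (\<lambda>v. L - 1 - int (rev_bits k v)) L"
proof
  fix m u v :: nat assume "m \<le> k" "u div 2 ^ (k - m) = v div 2 ^ (k - m)" "u \<noteq> v"
  from rev_bits_separated[OF this]
  show "2 ^ m \<le> \<bar>L - 1 - int (rev_bits k u) - (L - 1 - int (rev_bits k v))\<bar>"
    by linarith
next
  fix m b :: nat assume "m \<le> k" "2 ^ m \<le> L"
  \<comment> \<open>The window consists of the \<open>2 ^ m\<close> slots just below
    \<open>L\<close>; \<open>2 ^ m \<le> L\<close> keeps its start nonnegative.\<close>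
  with assms obtain u where "u div 2 ^ (k - m) = b" "L - 2 ^ m \<le> int (rev_bits k u)"
      "int (rev_bits k u) < L - 2 ^ m + 2 ^ m"
    using rev_bits_dense[of m k "L - 2 ^ m" b] by auto
  then show "\<exists>u. u div 2 ^ (k - m) = b \<and> 0 \<le> L - 1 - int (rev_bits k u)
      \<and> L - 1 - int (rev_bits k u) < 2 ^ m"
    by (intro exI[of _ u]) auto
qed (fact assms)

lemma target_scan_above:
  assumes "- 1 \<le> R"
  shows "target_scan k (\<lambda>v. int (rev_bits k v) - R - 1) (2 ^ k - 1 - R)"
proof
  fix m u v :: nat assume "m \<le> k" "u div 2 ^ (k - m) = v div 2 ^ (k - m)" "u \<noteq> v"
  from rev_bits_separated[OF this]
  show "2 ^ m \<le> \<bar>int (rev_bits k u) - R - 1 - (int (rev_bits k v) - R - 1)\<bar>"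
    by linarith
next
  fix m b :: nat assume "m \<le> k" "2 ^ m \<le> 2 ^ k - 1 - R"
  with assms obtain u where "u div 2 ^ (k - m) = b" "R + 1 \<le> int (rev_bits k u)"
      "int (rev_bits k u) < R + 1 + 2 ^ m"
    using rev_bits_dense[of m k "R + 1" b] by auto
  then show "\<exists>u. u div 2 ^ (k - m) = b \<and> 0 \<le> int (rev_bits k u) - R - 1
      \<and> int (rev_bits k u) - R - 1 < 2 ^ m"
    by (intro exI[of _ u]) auto
qed (use assms in simp)

theorem theorem2:
  fixes M :: "'a measure" and success :: "nat \<Rightarrow> 'a set"
    and k s :: nat and \<kappa> :: "nat \<Rightarrow> real" and \<kappa>' \<kappa>'' p :: real
  assumes "prob_space M"
    and "mono_on {..<2 ^ k} \<kappa>"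
    and "\<kappa>' \<le> \<kappa>''"
    and "s \<in> {0..2 ^ k - 1}"
    and "0 < p" and "p \<le> 1"
    and "prob_space.indep_events M success UNIV"
    and "\<And>t. measure M (success t) = p"
  shows "(\<integral>\<^sup>+ \<omega>. (\<Sum>t. of_bool (miss k \<kappa> \<kappa>' \<kappa>'' s (\<lambda>i. \<omega> \<in> success i) t)) \<partial>M)
    \<le> ennreal ((8 * real k + 4) / p + 2 * (1 - p) / p\<^sup>2)"
proof -
  interpret prob_space M by fact
  define L where "L = r_min (2 ^ k) \<kappa> \<kappa>'"
  define R where "R = r_max (2 ^ k) \<kappa> \<kappa>''"
  let ?count = "\<lambda>A. emeasure (count_space UNIV) A"
  let ?below = "\<lambda>\<omega>. {t. side_miss L (\<lambda>t. L - 1 - int (rev_bits k (s + t))) (\<lambda>i. \<omega> \<in> success i) t}"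
  let ?above = "\<lambda>\<omega>. {t. side_miss (2 ^ k - 1 - R) (\<lambda>t. int (rev_bits k (s + t)) - R - 1)
    (\<lambda>i. \<omega> \<in> success i) t}"
  have [measurable]: "success t \<in> events" for t
    using assms(7) by (auto simp: indep_events_def)
  have [measurable]: "(\<lambda>\<omega>. gap d y (\<lambda>i. \<omega> \<in> success i) t) \<in> measurable M (count_space UNIV)" for d y t
    by (intro measurable_gap) simp
  have [measurable]: "(\<lambda>\<omega>. ?count {t. side_miss d y (\<lambda>i. \<omega> \<in> success i) t}) \<in> borel_measurable M" for d y
    unfolding suminf_of_bool_eq_count[symmetric] side_miss_def by measurable
  have "(\<Sum>t. of_bool (miss k \<kappa> \<kappa>' \<kappa>'' s (\<lambda>i. \<omega> \<in> success i) t)) = ?count (?below \<omega> \<union> ?above \<omega>)" for \<omega>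
    unfolding suminf_of_bool_eq_count
    by (rule arg_cong[where f = ?count])
      (auto simp: miss_iff_side_miss[OF assms(2,3)] slot_eq_rev_bits L_def R_def)
  then have "(\<integral>\<^sup>+ \<omega>. (\<Sum>t. of_bool (miss k \<kappa> \<kappa>' \<kappa>'' s (\<lambda>i. \<omega> \<in> success i) t)) \<partial>M)
      = (\<integral>\<^sup>+ \<omega>. ?count (?below \<omega> \<union> ?above \<omega>) \<partial>M)"
    by simp
  also have "\<dots> \<le> (\<integral>\<^sup>+ \<omega>. ?count (?below \<omega>) + ?count (?above \<omega>) \<partial>M)"
    by (intro nn_integral_mono emeasure_subadditive) auto
  also have "\<dots> = (\<integral>\<^sup>+ \<omega>. ?count (?below \<omega>) \<partial>M) + (\<integral>\<^sup>+ \<omega>. ?count (?above \<omega>) \<partial>M)"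
    by (intro nn_integral_add) measurable
  also have "\<dots> \<le> ennreal ((4 * real k + 2) / p) + ennreal ((4 * real k + 2) / p)"
    using r_min_bounds(2)[of "2 ^ k" \<kappa> \<kappa>'] r_max_bounds(1)[of "2 ^ k" \<kappa> \<kappa>''] assms(5-8)
    by (intro add_mono expected_side_misses target_scan_below target_scan_above)
      (simp_all add: L_def R_def)
  also have "\<dots> = ennreal ((8 * real k + 4) / p)"
    using assms(5) by (simp add: ennreal_plus[symmetric] add_divide_distrib[symmetric] del: ennreal_plus)
  also have "\<dots> \<le> ennreal ((8 * real k + 4) / p + 2 * (1 - p) / p\<^sup>2)"
    using assms(5,6) by (intro ennreal_leI) simp
  finally show ?thesis .
qed

end
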